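(* For every positive integer $n$, a red-blue $K_n$ has at most \[\frac12\left\lfloor\frac{n^2}{4}\right\rfloor\left\lfloor\frac{(n-2)^2}{4}\right\rfloor\] alternating $4$-cycles. Moreover, for $n\ge4$, this is achieved if and only if the edges of one colour form a complete bipartite graph $K_{\lfloor n/2\rfloor,\lceil n/2\rceil}$ on all $n$ vertices.
   Context: A red-blue $K_n$ is a complete graph on $n$ vertices each of whose edges is coloured red or blue. An alternating $4$-cycle is a $4$-cycle (counted as a subgraph) whose edges are coloured red, blue, red, blue in cyclic order. *)

theory Defs
  imports Complex_Main
begin

datatype colour = Red | Blue

definition edges_on :: "'a set \<Rightarrow> 'a set set" where
  "edges_on V = {e. e \<subseteq> V \<and> card e = 2}"

definition colour_class :: "'a set \<Rightarrow> ('a set \<Rightarrow> colour) \<Rightarrow> colour \<Rightarrow> 'a set set" where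
  "colour_class V col k = {e \<in> edges_on V. col e = k}"

text \<open>A 4-cycle has no isolated vertices, so as a subgraph it is determined by its edge set;
  different labellings (rotations, reflections) of the same cycle yield the same element.\<close>

definition alternating_4_cycles :: "'a set \<Rightarrow> ('a set \<Rightarrow> colour) \<Rightarrow> 'a set set set" where
  "alternating_4_cycles V col =
     {{{a, b}, {b, c}, {c, d}, {d, a}} | a b c d.
        {a, b, c, d} \<subseteq> V \<and> distinct [a, b, c, d] \<and>
        col {a, b} = Red \<and> col {b, c} = Blue \<and> col {c, d} = Red \<and> col {d, a} = Blue}"

definition is_complete_bipartite :: "'a set \<Rightarrow> 'a set set \<Rightarrow> nat \<Rightarrow> nat \<Rightarrow> bool" where
  "is_complete_bipartite V E p q \<longleftrightarrow>
     (\<exists>A B. A \<union> B = V \<and> A \<inter> B = {} \<and> card A = p \<and> card B = q \<and>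
        E = {{a, b} | a b. a \<in> A \<and> b \<in> B})"

end

theory Submission
  imports Defs
begin

text \<open>Count alternating 4-cycles by their diagonals: if \<open>x\<close> vertices are joined in red to \<open>a\<close> and in
  blue to \<open>c\<close>, and \<open>y\<close> vertices the other way round, then \<open>w = x y\<close> alternating cycles have the
  diagonal \<open>ac\<close>, and every cycle has two diagonals. Let \<open>D = x + y\<close> and \<open>m = n - 2\<close>. Then
  \<open>4 w \<le> D\<^sup>2\<close>, \<open>D \<le> m\<close>, and the three values of \<open>D\<close> on a triangle add up to at most \<open>2 m\<close>. If \<open>ab\<close>
  maximises \<open>D\<close> then, for every other \<open>c\<close>, the values \<open>s\<close>, \<open>t\<close> of \<open>D\<close> on \<open>ac\<close>, \<open>bc\<close> satisfy
  \<open>s\<^sup>2 + t\<^sup>2 \<le> m\<^sup>2\<close>, so the weights of \<open>ac\<close> and \<open>bc\<close> add up to at most \<open>\<lfloor>m\<^sup>2 / 4\<rfloor>\<close>. Removing \<open>a\<close> and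
  \<open>b\<close> and inducting, as in Mantel's theorem, bounds the total weight by
  \<open>\<lfloor>n\<^sup>2 / 4\<rfloor> \<lfloor>m\<^sup>2 / 4\<rfloor>\<close>. In the case of equality every \<open>c\<close> has \<open>D = 0\<close> to exactly one of \<open>a\<close>
  and \<open>b\<close>, and these two classes are the parts of the bipartite graph.\<close>

section \<open>Weighted pairs\<close>

lemma sum_squares_le_of_triangle:
  fixes s t d m :: nat
  assumes "s \<le> d" "t \<le> d" "d \<le> m" "s + t + d \<le> 2 * m"
  shows "s\<^sup>2 + t\<^sup>2 \<le> m\<^sup>2"
proof -
  have main: "y\<^sup>2 + x\<^sup>2 \<le> m\<^sup>2" if "x \<le> y" "y \<le> d" "x + y + d \<le> 2 * m" for x y
  proof -
    have "int x + 2 * int y \<le> 2 * int m" "int y \<le> int m" using that assms(3) by linarith+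
    \<comment> \<open>Bounding one factor \<open>x\<close> by \<open>y\<close> and the other by
      \<open>2 * (m - y)\<close> gives
      \<open>x\<^sup>2 + y\<^sup>2 \<le> 2 * m * y - y\<^sup>2\<close>, which is
      \<open>m\<^sup>2 - (m - y)\<^sup>2\<close>.\<close>
    then have "int x * int x \<le> int y * (2 * (int m - int y))"
      using that(1) by (intro mult_mono) simp_all
    moreover have "0 \<le> (int m - int y)\<^sup>2" by simp
    ultimately have "int (y\<^sup>2 + x\<^sup>2) \<le> int (m\<^sup>2)"
      by (simp add: power2_eq_square algebra_simps)
    then show ?thesis by linarith
  qed
  show ?thesis
    using main[of s t] main[of t s] assms by (cases "s \<le> t") (simp_all add: add.commute)
qed

text \<open>The increment \<open>k + 1\<close> matches the removal of two vertices from
  \<open>k + 2\<close>: one unit for the removed pair and one for each remaining vertex.\<close>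

lemma square_div_4_step: "(k + 2)\<^sup>2 div 4 = k\<^sup>2 div 4 + k + (1::nat)"
proof -
  have "(k + 2)\<^sup>2 = k\<^sup>2 + 4 * (k + 1)" by (simp add: power2_eq_square algebra_simps)
  then show ?thesis by simp
qed

lemma sum_pairs_remove_two:
  fixes w :: "'a \<Rightarrow> 'a \<Rightarrow> nat"
  assumes "finite S" "a \<in> S" "b \<in> S" "a \<noteq> b"
    and sym: "\<And>u v. w u v = w v u" and diag: "\<And>u. w u u = 0"
  shows "(\<Sum>u\<in>S. \<Sum>v\<in>S. w u v) =
    (\<Sum>u\<in>S - {a, b}. \<Sum>v\<in>S - {a, b}. w u v) + 2 * w a b + 2 * (\<Sum>c\<in>S - {a, b}. w a c + w b c)"
proof -
  define R where "R = S - {a, b}"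
  have S: "S = insert a (insert b R)" "a \<notin> insert b R" "b \<notin> R" "finite R"
    using assms unfolding R_def by auto
  have "(\<Sum>u\<in>R. w u a) = (\<Sum>u\<in>R. w a u)" "(\<Sum>u\<in>R. w u b) = (\<Sum>u\<in>R. w b u)"
    using sym by (auto intro: sum.cong)
  then show ?thesis
    unfolding R_def[symmetric] using S sym[of b a] diag by (simp add: sum.distrib)
qed

text \<open>The induction needs only these properties of diagonals, so colours are absent. The
  parameter \<open>m\<close> belongs to \<open>V\<close> and stays fixed when the induction passes
  to subsets.\<close>

locale weighted_pairs =
  fixes V :: "'a set" and w D :: "'a \<Rightarrow> 'a \<Rightarrow> nat" and m :: nat
  assumes fin: "finite V"
    and w_sym: "w u v = w v u"
    and w_diag: "w u u = 0"
    and w_le: "4 * w u v \<le> (D u v)\<^sup>2"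
    and D_le: "u \<in> V \<Longrightarrow> v \<in> V \<Longrightarrow> u \<noteq> v \<Longrightarrow> D u v \<le> m"
    and D_triangle: "x \<in> V \<Longrightarrow> y \<in> V \<Longrightarrow> z \<in> V \<Longrightarrow> x \<noteq> y \<Longrightarrow> y \<noteq> z \<Longrightarrow> x \<noteq> z
      \<Longrightarrow> D x z + D y z + D x y \<le> 2 * m"
begin

lemma w_le_max: "u \<in> V \<Longrightarrow> v \<in> V \<Longrightarrow> u \<noteq> v \<Longrightarrow> w u v \<le> m\<^sup>2 div 4"
proof -
  assume "u \<in> V" "v \<in> V" "u \<noteq> v"
  then have "(D u v)\<^sup>2 \<le> m\<^sup>2" by (intro power_mono D_le) simp_all
  then show ?thesis using w_le[of u v] by linarith
qed

text \<open>The pair is chosen to maximise \<open>D\<close>, not \<open>w\<close>: then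
  \<open>D a b\<close> dominates the other two sides of every triangle on \<open>ab\<close> inside
  \<open>S\<close>, as \<open>sum_squares_le_of_triangle\<close> requires.\<close>

lemma obtain_heavy_pair:
  assumes "S \<subseteq> V" "card S \<ge> 2"
  obtains a b where "a \<in> S" "b \<in> S" "a \<noteq> b"
    "\<And>c. c \<in> S - {a, b} \<Longrightarrow> w a c + w b c \<le> m\<^sup>2 div 4"
proof -
  define P where "P = {(u, v). u \<in> S \<and> v \<in> S \<and> u \<noteq> v}"
  have "finite S" using assms fin finite_subset by blast
  then have finP: "finite P"
    by (intro finite_subset[of P "S \<times> S"]) (auto simp: P_def)
  obtain u v where "u \<in> S" "v \<in> S" "u \<noteq> v"
    using assms(2) card_le_Suc0_iff_eq[OF \<open>finite S\<close>] by force
  then have "P \<noteq> {}" by (auto simp: P_def)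
  then have "Max (case_prod D ` P) \<in> case_prod D ` P" using finP by simp
  then obtain a b where ab: "(a, b) \<in> P" and "Max (case_prod D ` P) = D a b" by auto
  then have mx: "D x y \<le> D a b" if "(x, y) \<in> P" for x y
    using Max_ge[of "case_prod D ` P" "D x y"] finP that by force
  have "w a c + w b c \<le> m\<^sup>2 div 4" if c: "c \<in> S - {a, b}" for c
  proof -
    have "(D a c)\<^sup>2 + (D b c)\<^sup>2 \<le> m\<^sup>2"
    proof (rule sum_squares_le_of_triangle)
      show "D a c \<le> D a b" "D b c \<le> D a b"
        using mx c ab by (auto simp: P_def)
      show "D a b \<le> m" using D_le ab assms(1) by (auto simp: P_def)
      show "D a c + D b c + D a b \<le> 2 * m"
        using c ab assms(1) by (intro D_triangle) (auto simp: P_def)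
    qed
    then show ?thesis using w_le[of a c] w_le[of b c] by linarith
  qed
  then show ?thesis using that ab by (auto simp: P_def)
qed

text \<open>Induction that removes a heavy pair. The factor 2 is there because the sum runs over
  ordered pairs.\<close>

lemma sum_pairs_le:
  "S \<subseteq> V \<Longrightarrow> (\<Sum>u\<in>S. \<Sum>v\<in>S. w u v) \<le> 2 * ((card S)\<^sup>2 div 4) * (m\<^sup>2 div 4)"
proof (induction "card S" arbitrary: S rule: less_induct)
  case less
  have "finite S" using less.prems fin finite_subset by blast
  show ?case
  proof (cases "card S \<ge> 2")
    case False
    then have "\<forall>u\<in>S. \<forall>v\<in>S. u = v"
      using card_le_Suc0_iff_eq[OF \<open>finite S\<close>] by simp
    then have "(\<Sum>u\<in>S. \<Sum>v\<in>S. w u v) = 0"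
      using w_diag by (intro sum.neutral ballI) metis
    then show ?thesis by simp
  next
    case True
    then obtain a b where ab: "a \<in> S" "b \<in> S" "a \<noteq> b"
      and le: "\<And>c. c \<in> S - {a, b} \<Longrightarrow> w a c + w b c \<le> m\<^sup>2 div 4"
      using obtain_heavy_pair[OF less.prems] by blast
    define R where "R = S - {a, b}"
    have cR: "card S = card R + 2"
      using ab \<open>finite S\<close> True by (simp add: R_def card_Diff_subset)
    have IH: "(\<Sum>u\<in>R. \<Sum>v\<in>R. w u v) \<le> 2 * ((card R)\<^sup>2 div 4) * (m\<^sup>2 div 4)"
      using less.prems cR by (intro less.hyps) (auto simp: R_def)
    have wab: "w a b \<le> m\<^sup>2 div 4" using w_le_max ab less.prems by blast
    have "(\<Sum>c\<in>R. w a c + w b c) \<le> card R * (m\<^sup>2 div 4)"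
      using sum_mono[of R "\<lambda>c. w a c + w b c" "\<lambda>_. m\<^sup>2 div 4"] le by (simp add: R_def)
    then show ?thesis
      using IH wab sum_pairs_remove_two[OF \<open>finite S\<close> ab w_sym w_diag]
      unfolding cR square_div_4_step R_def[symmetric] by (simp add: algebra_simps)
  qed
qed

text \<open>The inductive step adds up upper bounds for the rest, for \<open>w a b\<close> and for
  the pairs joining \<open>a\<close> or \<open>b\<close> to the rest. Equality in the total makes
  each of them tight, and the last one tight term by term.\<close>

lemma extremal_pair:
  assumes "card V \<ge> 2"
    and "(\<Sum>u\<in>V. \<Sum>v\<in>V. w u v) = 2 * ((card V)\<^sup>2 div 4) * (m\<^sup>2 div 4)"
  obtains a b where "a \<in> V" "b \<in> V" "a \<noteq> b" "w a b = m\<^sup>2 div 4"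
    "\<And>c. c \<in> V - {a, b} \<Longrightarrow> w a c + w b c = m\<^sup>2 div 4"
proof -
  obtain a b where ab: "a \<in> V" "b \<in> V" "a \<noteq> b"
    and le: "\<And>c. c \<in> V - {a, b} \<Longrightarrow> w a c + w b c \<le> m\<^sup>2 div 4"
    using obtain_heavy_pair[OF order.refl assms(1)] by blast
  define R where "R = V - {a, b}"
  have cR: "card V = card R + 2"
    using ab fin assms(1) by (simp add: R_def card_Diff_subset)
  have R: "(\<Sum>u\<in>R. \<Sum>v\<in>R. w u v) \<le> 2 * ((card R)\<^sup>2 div 4) * (m\<^sup>2 div 4)"
    by (rule sum_pairs_le) (auto simp: R_def)
  have wab: "w a b \<le> m\<^sup>2 div 4" using w_le_max ab by blast
  have sm: "(\<Sum>c\<in>R. w a c + w b c) \<le> card R * (m\<^sup>2 div 4)"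
    using sum_mono[of R "\<lambda>c. w a c + w b c" "\<lambda>_. m\<^sup>2 div 4"] le by (simp add: R_def)
  have eq: "(\<Sum>u\<in>R. \<Sum>v\<in>R. w u v) + 2 * w a b + 2 * (\<Sum>c\<in>R. w a c + w b c) =
      2 * ((card R)\<^sup>2 div 4) * (m\<^sup>2 div 4) + 2 * (m\<^sup>2 div 4) + 2 * (card R * (m\<^sup>2 div 4))"
    using assms(2) sum_pairs_remove_two[OF fin ab w_sym w_diag]
    unfolding cR square_div_4_step R_def[symmetric] by (simp add: algebra_simps)
  have wab': "w a b = m\<^sup>2 div 4" and "(\<Sum>c\<in>R. w a c + w b c) = card R * (m\<^sup>2 div 4)"
    using eq R wab sm by linarith+
  then have "(\<Sum>c\<in>R. w a c + w b c) = (\<Sum>c\<in>R. m\<^sup>2 div 4)" by simp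
  then have "w a c + w b c = m\<^sup>2 div 4" if "c \<in> R" for c
    using sum_mono_inv[of "\<lambda>c. w a c + w b c" R "\<lambda>_. m\<^sup>2 div 4" c] le that fin
    by (auto simp: R_def)
  then show ?thesis using that ab wab' by (auto simp: R_def)
qed

lemma extremal_partition:
  assumes "card V \<ge> 2" "m \<ge> 2"
    and "(\<Sum>u\<in>V. \<Sum>v\<in>V. w u v) = 2 * ((card V)\<^sup>2 div 4) * (m\<^sup>2 div 4)"
  obtains a b where "a \<in> V" "b \<in> V" "a \<noteq> b" "w a b = m\<^sup>2 div 4" "D a b = m"
    "\<And>c. c \<in> V - {a, b} \<Longrightarrow> D a c = 0 \<or> D b c = 0"
proof -
  obtain a b where ab: "a \<in> V" "b \<in> V" "a \<noteq> b" "w a b = m\<^sup>2 div 4"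
    and eq: "\<And>c. c \<in> V - {a, b} \<Longrightarrow> w a c + w b c = m\<^sup>2 div 4"
    using extremal_pair[OF assms(1,3)] by blast
  \<comment> \<open>Squares are 0 or 1 modulo 4, so rounding down loses at most 1 after
    multiplication by 4.\<close>
  have K: "m\<^sup>2 \<le> 4 * (m\<^sup>2 div 4) + 1"
  proof (cases "even m")
    case True
    then have "4 dvd m\<^sup>2" by (auto simp: power2_eq_square elim!: evenE)
    then show ?thesis by simp
  next
    case False
    then obtain i where "m = 2 * i + 1" by (elim oddE)
    then have "m\<^sup>2 = 4 * (i\<^sup>2 + i) + 1" by (simp add: power2_eq_square algebra_simps)
    then obtain j where "m\<^sup>2 = 4 * j + 1" by blast
    then show ?thesis by presburger
  qed
  have "D a b = m"
  proof (rule ccontr)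
    assume "D a b \<noteq> m"
    then have "D a b + 1 \<le> m" using D_le[of a b] ab by simp
    then have "(D a b + 1)\<^sup>2 \<le> m\<^sup>2" by (rule power_mono) simp
    moreover have "4 * (m\<^sup>2 div 4) \<le> (D a b)\<^sup>2" using w_le[of a b] ab by simp
    \<comment> \<open>Here \<open>(D a b + 1)\<^sup>2 \<le> m\<^sup>2 \<le> (D a b)\<^sup>2 +
      1\<close> leaves no room for the cross term \<open>2 * D a b\<close>.\<close>
    ultimately have "D a b = 0" using K by (simp add: power2_eq_square)
    then have "m\<^sup>2 \<le> 1" using K \<open>4 * (m\<^sup>2 div 4) \<le> (D a b)\<^sup>2\<close> by simp
    then show False using assms(2) power_mono[of 2 m 2] by simp
  qed
  moreover have "D a c = 0 \<or> D b c = 0" if c: "c \<in> V - {a, b}" for c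
  proof -
    have "D a c + D b c \<le> m"
      using D_triangle[of a b c] c ab \<open>D a b = m\<close> by force
    then have "(D a c + D b c)\<^sup>2 \<le> m\<^sup>2" by (rule power_mono) simp
    moreover have "m\<^sup>2 \<le> (D a c)\<^sup>2 + (D b c)\<^sup>2 + 1"
      using w_le[of a c] w_le[of b c] eq[OF c] K by linarith
    \<comment> \<open>The square of the sum exceeds the sum of squares by at most 1, while the
      difference is even; hence the product vanishes.\<close>
    ultimately have "2 * (D a c * D b c) \<le> 1"
      by (simp add: power2_eq_square algebra_simps)
    then have "D a c * D b c = 0" by linarith
    then show ?thesis by simp
  qed
  ultimately show ?thesis using that ab by blast
qed

end

section \<open>Counting cycles by diagonals\<close>

definition red_blue :: "'a set \<Rightarrow> ('a set \<Rightarrow> colour) \<Rightarrow> 'a \<Rightarrow> 'a \<Rightarrow> 'a set" where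
  "red_blue V col a c = {b \<in> V - {a, c}. col {a, b} = Red \<and> col {b, c} = Blue}"

definition diag_weight :: "'a set \<Rightarrow> ('a set \<Rightarrow> colour) \<Rightarrow> 'a \<Rightarrow> 'a \<Rightarrow> nat" where
  "diag_weight V col a c = card (red_blue V col a c) * card (red_blue V col c a)"

text \<open>This is the Hamming distance between the colours seen from \<open>a\<close> and from
  \<open>c\<close> on the other vertices; \<open>disagreement_eq\<close> gives that form.\<close>

definition disagreement :: "'a set \<Rightarrow> ('a set \<Rightarrow> colour) \<Rightarrow> 'a \<Rightarrow> 'a \<Rightarrow> nat" where
  "disagreement V col a c = card (red_blue V col a c) + card (red_blue V col c a)"

text \<open>Labelled cycles whose first edge is red; they are easier to count than edge
  sets.\<close>

definition alternating_quads ::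
    "'a set \<Rightarrow> ('a set \<Rightarrow> colour) \<Rightarrow> ('a \<times> 'a \<times> 'a \<times> 'a) set" where
  "alternating_quads V col = {(a, b, c, d). {a, b, c, d} \<subseteq> V \<and> distinct [a, b, c, d] \<and>
     col {a, b} = Red \<and> col {b, c} = Blue \<and> col {c, d} = Red \<and> col {d, a} = Blue}"

definition cycle_edges :: "'a \<times> 'a \<times> 'a \<times> 'a \<Rightarrow> 'a set set" where
  "cycle_edges = (\<lambda>(a, b, c, d). {{a, b}, {b, c}, {c, d}, {d, a}})"

lemma alternating_4_cycles_eq_image:
  "alternating_4_cycles V col = cycle_edges ` alternating_quads V col"
  unfolding alternating_4_cycles_def alternating_quads_def cycle_edges_def image_def
    Bex_def split_paired_Ex mem_Collect_eq prod.case
  by (intro Collect_cong ex_cong1) (rule conj_commute)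

lemma finite_alternating_quads: "finite V \<Longrightarrow> finite (alternating_quads V col)"
  by (rule finite_subset[of _ "V \<times> V \<times> V \<times> V"]) (auto simp: alternating_quads_def)

text \<open>Of the eight symmetries of a 4-cycle, only four preserve the colours: the identity, the
  half turn and the two reflections through midpoints of opposite edges.\<close>

lemma cycle_edges_fibre:
  assumes q: "(a, b, c, d) \<in> alternating_quads V col"
  shows "{p \<in> alternating_quads V col. cycle_edges p = cycle_edges (a, b, c, d)} =
    {(a, b, c, d), (b, a, d, c), (c, d, a, b), (d, c, b, a)}" (is "?L = ?R")
proof
  show "?R \<subseteq> ?L"
    using q by (auto simp: alternating_quads_def cycle_edges_def insert_commute)
  show "?L \<subseteq> ?R"
  proof
    fix p assume p: "p \<in> ?L"
    obtain a' b' c' d' where pe: "p = (a', b', c', d')" by (cases p)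
    have ne: "a \<noteq> b" "a \<noteq> c" "a \<noteq> d" "b \<noteq> c" "b \<noteq> d" "c \<noteq> d"
      and cl: "col {a, b} = Red" "col {b, c} = Blue" "col {c, d} = Red" "col {d, a} = Blue"
      using q by (auto simp: alternating_quads_def)
    have cl': "col {a', b'} = Red" "col {b', c'} = Blue" "col {c', d'} = Red"
      using p by (simp_all add: pe alternating_quads_def)
    have eq: "{{a', b'}, {b', c'}, {c', d'}, {d', a'}} = {{a, b}, {b, c}, {c, d}, {d, a}}"
      using p unfolding pe cycle_edges_def mem_Collect_eq prod.case by (rule conjunct2)
    have mem: "{a', b'} \<in> {{a, b}, {b, c}, {c, d}, {d, a}}"
        "{b', c'} \<in> {{a, b}, {b, c}, {c, d}, {d, a}}"
        "{c', d'} \<in> {{a, b}, {b, c}, {c, d}, {d, a}}"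
      unfolding eq[symmetric] by simp_all
    have red1: "{a', b'} = {a, b} \<or> {a', b'} = {c, d}"
      and blue: "{b', c'} = {b, c} \<or> {b', c'} = {d, a}"
      and red2: "{c', d'} = {a, b} \<or> {c', d'} = {c, d}"
      using mem cl cl' by (metis insert_iff empty_iff colour.distinct(1))+
    \<comment> \<open>The first red edge leaves four choices for \<open>(a', b')\<close>; the blue
      edge at \<open>b'\<close> then forces \<open>c'\<close>, and the other red edge forces
      \<open>d'\<close>.\<close>
    have "(a', b') \<in> {(a, b), (b, a), (c, d), (d, c)}"
      using red1 by (auto simp: doubleton_eq_iff)
    then have "(a', b', c') \<in> {(a, b, c), (b, a, d), (c, d, a), (d, c, b)}"
      using blue ne by (auto simp: doubleton_eq_iff)
    then show "p \<in> ?R"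
      using red2 ne by (auto simp: doubleton_eq_iff pe)
  qed
qed

lemma card_alternating_quads:
  assumes "finite V"
  shows "card (alternating_quads V col) = 4 * card (alternating_4_cycles V col)"
proof -
  have "card {p \<in> alternating_quads V col. cycle_edges p = e} = 4"
    if e: "e \<in> alternating_4_cycles V col" for e
  proof -
    obtain a b c d where q: "(a, b, c, d) \<in> alternating_quads V col"
      and "e = cycle_edges (a, b, c, d)"
      using e unfolding alternating_4_cycles_eq_image by auto
    then have "{p \<in> alternating_quads V col. cycle_edges p = e} =
      {(a, b, c, d), (b, a, d, c), (c, d, a, b), (d, c, b, a)}"
      using cycle_edges_fibre[OF q] by simp
    then show ?thesis using q by (simp add: alternating_quads_def)
  qed
  moreover have "card (alternating_quads V col) =
      (\<Sum>e\<in>alternating_4_cycles V col. card {p \<in> alternating_quads V col. cycle_edges p = e})"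
    using sum.group[of "alternating_quads V col" "alternating_4_cycles V col" cycle_edges "\<lambda>_. 1::nat"]
      finite_alternating_quads[OF assms, of col]
    by (simp add: alternating_4_cycles_eq_image)
  ultimately show ?thesis by simp
qed

lemma finite_red_blue: "finite V \<Longrightarrow> finite (red_blue V col a c)"
  by (simp add: red_blue_def)

lemma red_blue_self: "red_blue V col a a = {}"
  by (auto simp: red_blue_def insert_commute)

text \<open>Once the diagonal \<open>(a, c)\<close> is fixed, \<open>b\<close> and \<open>d\<close>
  are chosen independently. They differ automatically, since \<open>a\<close> sees one in red and
  the other in blue; for \<open>a = c\<close> there is no choice by
  \<open>red_blue_self\<close>.\<close>

lemma card_alternating_quads_eq_sum:
  assumes "finite V"
  shows "card (alternating_quads V col) = (\<Sum>a\<in>V. \<Sum>c\<in>V. diag_weight V col a c)"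
proof -
  define Q where "Q = (SIGMA ac:V \<times> V.
    red_blue V col (fst ac) (snd ac) \<times> red_blue V col (snd ac) (fst ac))"
  have "card (alternating_quads V col) = card Q"
  proof (rule bij_betw_same_card)
    show "bij_betw (\<lambda>(a, b, c, d). ((a, c), (b, d))) (alternating_quads V col) Q"
      by (rule bij_betw_byWitness[where f' = "\<lambda>((a, c), (b, d)). (a, b, c, d)"])
        (auto simp: alternating_quads_def Q_def red_blue_def insert_commute)
  qed
  also have "\<dots> = (\<Sum>ac\<in>V \<times> V. diag_weight V col (fst ac) (snd ac))"
    unfolding Q_def using assms
    by (subst card_SigmaI) (auto simp: finite_red_blue diag_weight_def card_cartesian_product)
  also have "\<dots> = (\<Sum>a\<in>V. \<Sum>c\<in>V. diag_weight V col a c)"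
    by (simp add: sum.cartesian_product case_prod_unfold)
  finally show ?thesis .
qed

section \<open>Disagreement as a distance between vertices\<close>

lemma disagreement_eq:
  assumes "finite V"
  shows "disagreement V col a c = card {v \<in> V - {a, c}. col {a, v} \<noteq> col {c, v}}"
proof -
  have "{v \<in> V - {a, c}. col {a, v} \<noteq> col {c, v}} = red_blue V col a c \<union> red_blue V col c a"
    unfolding red_blue_def by (auto simp: insert_commute) (metis colour.exhaust)+
  moreover have "red_blue V col a c \<inter> red_blue V col c a = {}"
    by (auto simp: red_blue_def insert_commute)
  ultimately show ?thesis
    using assms by (simp add: disagreement_def card_Un_disjoint finite_red_blue)
qed

text \<open>Among three values of a two-valued colour at most two of the three pairs differ. So each
  of the \<open>n - 3\<close> outside vertices contributes at most 2. The vertices \<open>x\<close>,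
  \<open>y\<close>, \<open>z\<close> each witness one pair, and together compare the three edge
  colours of the triangle, which gives at most 2 more.\<close>

lemma disagreement_triangle:
  assumes "finite V" "x \<in> V" "y \<in> V" "z \<in> V" "x \<noteq> y" "y \<noteq> z" "x \<noteq> z"
  shows "disagreement V col x z + disagreement V col y z + disagreement V col x y
    \<le> 2 * (card V - 2)"
proof -
  define W where "W = V - {x, y, z}"
  have W: "finite W" "x \<notin> W" "y \<notin> W" "z \<notin> W" using assms by (auto simp: W_def)
  have V: "card V = card W + 3"
  proof -
    have "V = insert x (insert y (insert z W))" using assms by (auto simp: W_def)
    then show ?thesis using W assms by simp
  qed
  have D: "disagreement V col u v =
      (\<Sum>s\<in>W. of_bool (col {u, s} \<noteq> col {v, s})) + of_bool (col {u, t} \<noteq> col {v, t})"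
    if "{u, v, t} = {x, y, z}" "u \<noteq> v" "v \<noteq> t" "u \<noteq> t" for u v t
  proof -
    have eq: "V - {u, v} = insert t W" "t \<notin> W"
      using that assms by (auto simp: W_def)
    have count: "card {s \<in> A. P s} = (\<Sum>s\<in>A. of_bool (P s))" if "finite A" for A :: "'a set" and P
      using that by (simp add: of_bool_def sum.If_cases Int_def)
    have "disagreement V col u v = (\<Sum>s\<in>insert t W. of_bool (col {u, s} \<noteq> col {v, s}))"
      using disagreement_eq[OF assms(1), of col u v] W(1) unfolding eq(1)
      by (simp only: count finite_insert)
    then show ?thesis using W eq by simp
  qed
  have two: "of_bool (p \<noteq> r) + of_bool (q \<noteq> r) + of_bool (p \<noteq> q) \<le> (2::nat)" for p q r :: colour
    by (cases p; cases q; cases r) auto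
  have "(\<Sum>s\<in>W. of_bool (col {x, s} \<noteq> col {z, s})) + (\<Sum>s\<in>W. of_bool (col {y, s} \<noteq> col {z, s}))
      + (\<Sum>s\<in>W. of_bool (col {x, s} \<noteq> col {y, s})) \<le> (\<Sum>s\<in>W. 2::nat)"
    unfolding sum.distrib[symmetric] by (intro sum_mono two)
  moreover have "of_bool (col {x, y} \<noteq> col {z, y}) + of_bool (col {y, x} \<noteq> col {z, x})
      + of_bool (col {x, z} \<noteq> col {y, z}) \<le> (2::nat)"
    using two[of "col {x, y}" "col {y, z}" "col {x, z}"] by (simp add: insert_commute)
  ultimately show ?thesis
    using D[of x z y] D[of y z x] D[of x y z] assms V by (simp add: insert_commute)
qed

lemma weighted_pairs_diag_weight:
  assumes "finite V"
  shows "weighted_pairs V (diag_weight V col) (disagreement V col) (card V - 2)"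
proof
  show "diag_weight V col u v = diag_weight V col v u" for u v
    by (simp add: diag_weight_def)
  show "diag_weight V col u u = 0" for u
    by (simp add: diag_weight_def red_blue_self)
  show "4 * diag_weight V col u v \<le> (disagreement V col u v)\<^sup>2" for u v
  proof -
    have "4 * (p * q) \<le> (p + q)\<^sup>2" for p q :: nat
    proof -
      have "0 \<le> (int p - int q)\<^sup>2" by simp
      then have "int (4 * (p * q)) \<le> int ((p + q)\<^sup>2)"
        by (simp add: power2_eq_square algebra_simps)
      then show ?thesis by linarith
    qed
    then show ?thesis by (simp add: diag_weight_def disagreement_def)
  qed
  show "disagreement V col u v \<le> card V - 2" if "u \<in> V" "v \<in> V" "u \<noteq> v" for u v
  proof -
    have "disagreement V col u v \<le> card (V - {u, v})"
      unfolding disagreement_eq[OF assms] using assms by (intro card_mono) auto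
    then show ?thesis using that assms by (simp add: card_Diff_subset)
  qed
qed (rule assms, rule disagreement_triangle[OF assms])

section \<open>Bipartite colourings\<close>

text \<open>Vertexwise form of the statement that, for disjoint parts, the edges of colour
  \<open>k\<close> form the complete bipartite graph between them;
  \<open>colour_class_bipartite_iff\<close> proves the equivalence.\<close>

definition bipartite_colouring ::
    "'a set \<Rightarrow> 'a set \<Rightarrow> colour \<Rightarrow> ('a set \<Rightarrow> colour) \<Rightarrow> bool" where
  "bipartite_colouring A B k col \<longleftrightarrow>
     (\<forall>u\<in>A. \<forall>v\<in>B. col {u, v} = k) \<and>
     (\<forall>u\<in>A. \<forall>v\<in>A. u \<noteq> v \<longrightarrow> col {u, v} \<noteq> k) \<and>
     (\<forall>u\<in>B. \<forall>v\<in>B. u \<noteq> v \<longrightarrow> col {u, v} \<noteq> k)"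

lemma bipartite_colouring_commute:
  "bipartite_colouring A B k col \<Longrightarrow> bipartite_colouring B A k col"
  unfolding bipartite_colouring_def by (metis insert_commute)

lemma colour_class_bipartite_iff:
  assumes "A \<inter> B = {}"
  shows "colour_class (A \<union> B) col k = {{a, b} | a b. a \<in> A \<and> b \<in> B}
    \<longleftrightarrow> bipartite_colouring A B k col" (is "?C = ?E \<longleftrightarrow> ?P")
proof
  assume eq: "?C = ?E"
  have mem: "{u, v} \<in> ?C \<longleftrightarrow> col {u, v} = k" if "u \<in> A \<union> B" "v \<in> A \<union> B" "u \<noteq> v" for u v
    using that by (auto simp: colour_class_def edges_on_def)
  have cross: "{u, v} \<in> ?E \<longleftrightarrow> u \<in> A \<and> v \<in> B \<or> u \<in> B \<and> v \<in> A" for u v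
    by (auto simp: doubleton_eq_iff)
  have iff: "col {u, v} = k \<longleftrightarrow> u \<in> A \<and> v \<in> B \<or> u \<in> B \<and> v \<in> A"
    if "u \<in> A \<union> B" "v \<in> A \<union> B" "u \<noteq> v" for u v
    using mem[OF that] cross[of u v] eq by simp
  show ?P
    unfolding bipartite_colouring_def using iff assms by blast
next
  assume P: ?P
  show "?C = ?E"
  proof
    show "?E \<subseteq> ?C"
      using P assms by (auto simp: bipartite_colouring_def colour_class_def edges_on_def card_insert_if disjoint_iff)
    show "?C \<subseteq> ?E"
    proof
      fix e assume "e \<in> ?C"
      then obtain u v where e: "e = {u, v}" "u \<noteq> v" "u \<in> A \<union> B" "v \<in> A \<union> B" "col {u, v} = k"
        by (auto simp: colour_class_def edges_on_def card_2_iff)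
      then have "u \<in> A \<and> v \<in> B \<or> v \<in> A \<and> u \<in> B"
        using P by (auto simp: bipartite_colouring_def)
      then show "e \<in> ?E" using e(1) by (auto simp: insert_commute)
    qed
  qed
qed

text \<open>Every other vertex sees \<open>a\<close> and \<open>b\<close> in different colours, and
  its part decides which is which. The two red-blue sets are therefore \<open>A - {a}\<close> and
  \<open>B - {b}\<close>, in an order depending on \<open>k\<close>.\<close>

lemma diag_weight_cross:
  assumes P: "bipartite_colouring A B k col" and "A \<inter> B = {}" "finite A" "finite B"
    and ab: "a \<in> A" "b \<in> B"
  shows "diag_weight (A \<union> B) col a b = (card A - 1) * (card B - 1)"
proof -
  have fromA: "col {a, v} = k \<and> col {v, b} \<noteq> k" if "v \<in> B - {b}" for v
    using P ab that unfolding bipartite_colouring_def by auto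
  have fromB: "col {a, v} \<noteq> k \<and> col {v, b} = k" if "v \<in> A - {a}" for v
    using P ab that unfolding bipartite_colouring_def by auto
  have V: "A \<union> B - {a, b} = (A - {a}) \<union> (B - {b})" "(A - {a}) \<inter> (B - {b}) = {}"
    using ab assms(2) by auto
  show ?thesis
  proof (cases k)
    case Red
    have "red_blue (A \<union> B) col a b = B - {b}"
      unfolding red_blue_def V(1) using fromA fromB Red
      by auto (metis colour.exhaust)+
    moreover have "red_blue (A \<union> B) col b a = A - {a}"
      unfolding red_blue_def insert_commute[of b] V(1) using fromA fromB Red
      by (auto simp: insert_commute) (metis colour.exhaust)+
    ultimately show ?thesis using ab assms by (simp add: diag_weight_def)
  next
    case Blue
    have "red_blue (A \<union> B) col a b = A - {a}"
      unfolding red_blue_def V(1) using fromA fromB Blue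
      by auto (metis colour.exhaust)+
    moreover have "red_blue (A \<union> B) col b a = B - {b}"
      unfolding red_blue_def insert_commute[of b] V(1) using fromA fromB Blue
      by (auto simp: insert_commute) (metis colour.exhaust)+
    ultimately show ?thesis using ab assms by (simp add: diag_weight_def)
  qed
qed

text \<open>Two vertices of one part see every other vertex in the same colour.\<close>

lemma diag_weight_same:
  assumes P: "bipartite_colouring A B k col" and "u \<in> A" "v \<in> A"
  shows "diag_weight (A \<union> B) col u v = 0"
proof -
  have "col {u, x} = col {x, v}" if "x \<in> A \<union> B - {u, v}" for x
  proof (cases "x \<in> A")
    case True
    then have "col {u, x} \<noteq> k" "col {x, v} \<noteq> k"
      using P assms that unfolding bipartite_colouring_def by auto
    then show ?thesis by (cases k; cases "col {u, x}"; cases "col {x, v}") simp_all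
  next
    case False
    then have "col {u, x} = k" "col {v, x} = k"
      using P assms that unfolding bipartite_colouring_def by auto
    then show ?thesis by (simp add: insert_commute)
  qed
  then have "red_blue (A \<union> B) col u v = {}"
    by (auto simp: red_blue_def)
  then show ?thesis by (simp add: diag_weight_def)
qed

lemma sum_diag_weight_bipartite:
  assumes P: "bipartite_colouring A B k col" and d: "A \<inter> B = {}" "finite A" "finite B"
  shows "(\<Sum>u\<in>A \<union> B. \<Sum>v\<in>A \<union> B. diag_weight (A \<union> B) col u v) =
    2 * (card A * card B) * ((card A - 1) * (card B - 1))"
proof -
  let ?w = "diag_weight (A \<union> B) col"
  note P' = bipartite_colouring_commute[OF P]
  have AA: "?w u v = 0" if "u \<in> A" "v \<in> A" for u v
    using diag_weight_same[OF P that] .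
  have BB: "?w u v = 0" if "u \<in> B" "v \<in> B" for u v
    using diag_weight_same[OF P' that] by (simp add: Un_commute)
  have AB: "?w u v = (card A - 1) * (card B - 1)" if "u \<in> A" "v \<in> B" for u v
    using diag_weight_cross[OF P d that] .
  have BA: "?w v u = (card A - 1) * (card B - 1)" if "u \<in> A" "v \<in> B" for u v
    using AB[OF that] by (simp add: diag_weight_def mult.commute)
  have "(\<Sum>v\<in>A \<union> B. ?w u v) = card B * ((card A - 1) * (card B - 1))" if "u \<in> A" for u
    using that d AA AB by (simp add: sum.union_disjoint)
  moreover have "(\<Sum>v\<in>A \<union> B. ?w u v) = card A * ((card A - 1) * (card B - 1))" if "u \<in> B" for u
    using that d BB BA by (simp add: sum.union_disjoint)
  ultimately have "(\<Sum>u\<in>A \<union> B. \<Sum>v\<in>A \<union> B. ?w u v) =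
    card A * (card B * ((card A - 1) * (card B - 1)))
      + card B * (card A * ((card A - 1) * (card B - 1)))"
    by (subst sum.union_disjoint) (use d in simp_all)
  then show ?thesis
    by (simp only: mult_2 distrib_right mult.assoc mult.left_commute[of "card B" "card A"])
qed

text \<open>In the extremal case every further vertex is a twin of \<open>a\<close> or of
  \<open>b\<close>, that is, has disagreement 0 with it; the twin classes are the parts. The product
  equation restates that \<open>ab\<close> has maximal weight and later yields balance.\<close>

lemma extremal_imp_bipartite:
  assumes "finite V" "card V \<ge> 4"
    and "(\<Sum>u\<in>V. \<Sum>v\<in>V. diag_weight V col u v)
      = 2 * ((card V)\<^sup>2 div 4) * ((card V - 2)\<^sup>2 div 4)"
  obtains A B k where "A \<union> B = V" "A \<inter> B = {}" "bipartite_colouring A B k col"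
    "A \<noteq> {}" "B \<noteq> {}" "(card A - 1) * (card B - 1) = (card V - 2)\<^sup>2 div 4"
proof -
  interpret weighted_pairs V "diag_weight V col" "disagreement V col" "card V - 2"
    by (rule weighted_pairs_diag_weight[OF assms(1)])
  have two: "2 \<le> card V" "2 \<le> card V - 2" using assms(2) by simp_all
  obtain a b where ab: "a \<in> V" "b \<in> V" "a \<noteq> b"
    and wab: "diag_weight V col a b = (card V - 2)\<^sup>2 div 4"
    and Dab: "disagreement V col a b = card V - 2"
    and part: "\<And>c. c \<in> V - {a, b} \<Longrightarrow> disagreement V col a c = 0 \<or> disagreement V col b c = 0"
    using extremal_partition[OF two assms(3)] by blast
  \<comment> \<open>\<open>D a b\<close> equals the number of remaining vertices, so
    \<open>a\<close> and \<open>b\<close> disagree on all of them.\<close>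
  have opposite: "col {a, v} \<noteq> col {b, v}" if "v \<in> V - {a, b}" for v
  proof -
    have "{v \<in> V - {a, b}. col {a, v} \<noteq> col {b, v}} = V - {a, b}"
    proof (rule card_subset_eq)
      show "card {v \<in> V - {a, b}. col {a, v} \<noteq> col {b, v}} = card (V - {a, b})"
        using Dab ab assms(1) unfolding disagreement_eq[OF assms(1)]
        by (simp add: card_Diff_subset)
    qed (use assms(1) in auto)
    then show ?thesis using that by blast
  qed
  have twin: "col {u, v} = col {c, v}" if "disagreement V col u c = 0" "v \<in> V - {u, c}" for u c v
    using that assms(1) by (auto simp: disagreement_eq)
  define k where "k = col {a, b}"
  define B where "B = insert b {c \<in> V - {a, b}. disagreement V col b c = 0}"
  \<comment> \<open>Vertices not put into \<open>B\<close> are \<open>a\<close> itself and, by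
    \<open>part\<close>, twins of \<open>a\<close>.\<close>
  define A where "A = V - B"
  have A: "c \<in> V - {a, b} \<and> disagreement V col a c = 0" if "c \<in> A" "c \<noteq> a" for c
    using that part[of c] by (auto simp: A_def B_def)
  have B: "c \<in> V - {a, b} \<and> disagreement V col b c = 0" if "c \<in> B" "c \<noteq> b" for c
    using that by (auto simp: B_def)
  have aA: "a \<in> A" and bB: "b \<in> B" using ab by (auto simp: A_def B_def)
  have V: "A \<union> B = V" "A \<inter> B = {}" using ab by (auto simp: A_def B_def)
  \<comment> \<open>A twin of \<open>a\<close> agrees with \<open>a\<close> at the vertex
    \<open>b\<close>, where the colour is \<open>k\<close>.\<close>
  have bA: "col {b, c} = k" if "c \<in> A" for c
    using twin[of a c b] A[OF that] that ab by (cases "c = a") (auto simp: k_def insert_commute)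
  have aB: "col {a, c} = k" if "c \<in> B" for c
    using twin[of b c a] B[OF that] that ab by (cases "c = b") (auto simp: k_def insert_commute)
  have aA': "col {a, c} \<noteq> k" if "c \<in> A" "c \<noteq> a" for c
    using opposite[of c] A[OF that] bA[OF that(1)] by auto
  have bB': "col {b, c} \<noteq> k" if "c \<in> B" "c \<noteq> b" for c
    using opposite[of c] B[OF that] aB[OF that(1)] by auto
  have "bipartite_colouring A B k col"
    unfolding bipartite_colouring_def
  proof (intro conjI ballI impI)
    fix u v assume uv: "u \<in> A" "v \<in> B"
    show "col {u, v} = k"
    proof (cases "u = a")
      case True
      then show ?thesis using aB uv by simp
    next
      case False
      have "v \<in> V - {a, u}" using uv aA V by auto
      then show ?thesis using twin[of a u v] A[OF uv(1) False] aB[OF uv(2)] by simp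
    qed
  next
    fix u v assume uv: "u \<in> A" "v \<in> A" "u \<noteq> v"
    show "col {u, v} \<noteq> k"
    proof (cases "u = a \<or> v = a")
      case True
      then show ?thesis using aA'[of u] aA'[of v] uv by (auto simp: insert_commute)
    next
      case False
      then show ?thesis using twin[of a u v] A[of u] A[of v] aA'[of v] uv by auto
    qed
  next
    fix u v assume uv: "u \<in> B" "v \<in> B" "u \<noteq> v"
    show "col {u, v} \<noteq> k"
    proof (cases "u = b \<or> v = b")
      case True
      then show ?thesis using bB'[of u] bB'[of v] uv by (auto simp: insert_commute)
    next
      case False
      then show ?thesis using twin[of b u v] B[of u] B[of v] bB'[of v] uv by auto
    qed
  qed
  moreover from this have "(card A - 1) * (card B - 1) = (card V - 2)\<^sup>2 div 4"
    using diag_weight_cross[of A B k col a b] V aA bB wab assms(1)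
    by (metis finite_Un)
  ultimately show ?thesis using that V aA bB by blast
qed

section \<open>Balanced parts and the equality case\<close>

lemma balanced_of_prod:
  fixes p q :: nat
  assumes "p * q = (p + q)\<^sup>2 div 4"
  shows "p \<le> q + 1 \<and> q \<le> p + 1"
proof -
  have "(p + q)\<^sup>2 < 4 * (p * q) + 4" unfolding assms by linarith
  then have "int ((p + q)\<^sup>2) < int (4 * (p * q) + 4)" by linarith
  \<comment> \<open>This uses \<open>(p - q)\<^sup>2 = (p + q)\<^sup>2 - 4 * p * q\<close>.\<close>
  then have "(int p - int q)\<^sup>2 < 2\<^sup>2" by (simp add: power2_eq_square algebra_simps)
  then have "\<bar>int p - int q\<bar> < 2" using power2_less_imp_less[of "\<bar>int p - int q\<bar>" 2] by simp
  then show ?thesis by linarith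
qed

lemma half_times_half: "(n div 2) * (n - n div 2) = (n::nat)\<^sup>2 div 4"
proof (cases "even n")
  case True
  then show ?thesis by (elim evenE) (simp add: power2_eq_square)
next
  case False
  then obtain i where i: "n = 2 * i + 1" by (elim oddE)
  then have "n\<^sup>2 = 4 * (i * (i + 1)) + 1" by (simp add: power2_eq_square algebra_simps)
  moreover have "n div 2 = i" "n - n div 2 = i + 1" using i by simp_all
  ultimately show ?thesis by simp
qed

lemma sum_diag_weight_eq_max_iff:
  assumes fin: "finite V" and n: "card V \<ge> 4"
  shows "(\<Sum>u\<in>V. \<Sum>v\<in>V. diag_weight V col u v)
      = 2 * ((card V)\<^sup>2 div 4) * ((card V - 2)\<^sup>2 div 4)
    \<longleftrightarrow> (\<exists>k. is_complete_bipartite V (colour_class V col k) (card V div 2) (card V - card V div 2))"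
    (is "?S = ?M \<longleftrightarrow> _")
proof
  assume "?S = ?M"
  then obtain A B k where AB: "A \<union> B = V" "A \<inter> B = {}" "bipartite_colouring A B k col"
    "A \<noteq> {}" "B \<noteq> {}" "(card A - 1) * (card B - 1) = (card V - 2)\<^sup>2 div 4"
    using extremal_imp_bipartite[OF fin n] by blast
  have finAB: "finite A" "finite B" using AB fin by auto
  have c: "card V = card A + card B" using AB finAB card_Un_disjoint by metis
  have pos: "card A \<ge> 1" "card B \<ge> 1" using AB finAB by (simp_all add: Suc_leI card_gt_0_iff)
  \<comment> \<open>Balance is read off from the part sizes less one, whose product is maximal for
    their sum; both parts are nonempty, so the truncated subtractions are exact.\<close>
  have "card V - 2 = (card A - 1) + (card B - 1)" using c pos by simp
  then have "card A - 1 \<le> card B - 1 + 1 \<and> card B - 1 \<le> card A - 1 + 1"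
    using balanced_of_prod AB(6) by metis
  then consider "card A = card V div 2" "card B = card V - card V div 2"
    | "card B = card V div 2" "card A = card V - card V div 2"
    using c pos by linarith
  then show "\<exists>k. is_complete_bipartite V (colour_class V col k) (card V div 2) (card V - card V div 2)"
  proof cases
    case 1
    then show ?thesis
      unfolding is_complete_bipartite_def
      using colour_class_bipartite_iff[OF AB(2), of col k] AB(1-3)
      by (intro exI[of _ k] exI[of _ A] exI[of _ B]) simp
  next
    case 2
    have "B \<inter> A = {}" "B \<union> A = V" using AB by auto
    then show ?thesis
      unfolding is_complete_bipartite_def
      using 2 colour_class_bipartite_iff[of B A col k] bipartite_colouring_commute[OF AB(3)]
      by (intro exI[of _ k] exI[of _ B] exI[of _ A]) simp
  qed
next
  assume "\<exists>k. is_complete_bipartite V (colour_class V col k) (card V div 2) (card V - card V div 2)"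
  then obtain A B k where AB: "A \<union> B = V" "A \<inter> B = {}"
    and c: "card A = card V div 2" "card B = card V - card V div 2"
    and E: "colour_class V col k = {{a, b} | a b. a \<in> A \<and> b \<in> B}"
    unfolding is_complete_bipartite_def by (elim exE conjE) (rule that)
  have P: "bipartite_colouring A B k col"
    using colour_class_bipartite_iff[OF AB(2), of col k] E AB(1) by simp
  \<comment> \<open>Taking one vertex from each half of \<open>n\<close> leaves the two halves of
    \<open>n - 2\<close>, so \<open>half_times_half\<close> applies to both factors.\<close>
  have "card A - 1 = (card V - 2) div 2" "card B - 1 = card V - 2 - (card V - 2) div 2"
    using c n by linarith+
  then have "(card A - 1) * (card B - 1) = (card V - 2)\<^sup>2 div 4"
    by (simp only: half_times_half)
  moreover have "card A * card B = (card V)\<^sup>2 div 4"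
    unfolding c by (rule half_times_half)
  moreover have "?S = 2 * (card A * card B) * ((card A - 1) * (card B - 1))"
    using sum_diag_weight_bipartite[OF P AB(2)] AB fin by auto
  ultimately show "?S = ?M" by simp
qed

section \<open>Transfer to the real-valued bound\<close>

lemma floor_real_square_div_4: "\<lfloor>(real n)\<^sup>2 / 4\<rfloor> = int (n\<^sup>2 div 4)"
  using floor_divide_of_nat_eq[of "n\<^sup>2" 4, where 'a = real] by simp

theorem theorem1p6:
  fixes n :: nat and V :: "'a set" and col :: "'a set \<Rightarrow> colour"
  assumes "n \<ge> 1" and "finite V" and "card V = n"
  shows "real (card (alternating_4_cycles V col))
           \<le> 1 / 2 * of_int \<lfloor>(real n)\<^sup>2 / 4\<rfloor> * of_int \<lfloor>(real n - 2)\<^sup>2 / 4\<rfloor>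
       \<and> (n \<ge> 4 \<longrightarrow>
           (real (card (alternating_4_cycles V col))
              = 1 / 2 * of_int \<lfloor>(real n)\<^sup>2 / 4\<rfloor> * of_int \<lfloor>(real n - 2)\<^sup>2 / 4\<rfloor>
            \<longleftrightarrow> (\<exists>k. is_complete_bipartite V (colour_class V col k)
                       (nat \<lfloor>real n / 2\<rfloor>) (nat \<lceil>real n / 2\<rceil>))))"
proof -
  let ?C = "card (alternating_4_cycles V col)"
  let ?S = "\<Sum>u\<in>V. \<Sum>v\<in>V. diag_weight V col u v"
  let ?M = "(n\<^sup>2 div 4) * ((n - 2)\<^sup>2 div 4)"
  interpret weighted_pairs V "diag_weight V col" "disagreement V col" "card V - 2"
    by (rule weighted_pairs_diag_weight[OF assms(2)])
  have S: "?S = 4 * ?C"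
    using card_alternating_quads card_alternating_quads_eq_sum assms(2) by metis
  have "?S \<le> 2 * ?M"
    using sum_pairs_le[OF order.refl] assms(3) by (simp add: mult.assoc)
  then have le: "2 * ?C \<le> ?M" using S by linarith
  have bound: "1 / 2 * of_int \<lfloor>(real n)\<^sup>2 / 4\<rfloor> * of_int \<lfloor>(real n - 2)\<^sup>2 / 4\<rfloor> = real ?M / 2"
  \<comment> \<open>For \<open>n = 1\<close> the real difference is -1 and the natural one is 0, but
    both sides vanish because the first floor is 0.\<close>
  proof (cases "n = 1")
    case True
    then show ?thesis by simp
  next
    case False
    then have "real n - 2 = real (n - 2)" using assms(1) by simp
    then show ?thesis by (simp only: floor_real_square_div_4 of_nat_mult of_int_of_nat_eq)
  qed
  have "2 * real ?C \<le> real ?M" using le by (metis of_nat_le_iff of_nat_mult of_nat_numeral)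
  moreover have "real ?C = real ?M / 2 \<longleftrightarrow>
      (\<exists>k. is_complete_bipartite V (colour_class V col k) (nat \<lfloor>real n / 2\<rfloor>) (nat \<lceil>real n / 2\<rceil>))"
    if "n \<ge> 4"
  proof -
    have "real ?C = real ?M / 2 \<longleftrightarrow> real (2 * ?C) = real ?M" by auto
    also have "\<dots> \<longleftrightarrow> ?S = 2 * (n\<^sup>2 div 4) * ((n - 2)\<^sup>2 div 4)"
      unfolding S of_nat_eq_iff by linarith
    also have "\<dots> \<longleftrightarrow> (\<exists>k. is_complete_bipartite V (colour_class V col k) (n div 2) (n - n div 2))"
      using sum_diag_weight_eq_max_iff[OF assms(2)] that assms(3) by metis
    also have "n div 2 = nat \<lfloor>real n / 2\<rfloor>" by linarith
    also have "n - nat \<lfloor>real n / 2\<rfloor> = nat \<lceil>real n / 2\<rceil>" by linarith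
    finally show ?thesis .
  qed
  ultimately show ?thesis unfolding bound by simp
qed

end
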